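(* Let $p\in(-\infty,0)\cup(1,\infty)$, and let $\epsilon=0$ if $p>1$ and $\epsilon=1$ if $p<0$. Put $\epsilon_2=(-1)^\epsilon$. Then the function $\Lambda_p:(a_*,0)\longrightarrow\mathbb{R}$ given by $$\Lambda_p(a)=2p(p-1)^2\sqrt{-a}\int_\beta^\alpha \frac{\kappa^{2(p-1)}}{\left(a+\epsilon_2p^2\kappa^{2(p-1)}\right)\sqrt{a-\epsilon_2(p-1)^2\kappa^{2p}+\epsilon_2p^2\kappa^{2(p-1)}}}\,d\kappa$$ is continuous, and $$\lim_{a\to a_*^+}\Lambda_p(a)=\sqrt{2}\,\pi .$$
   Context: Here $a_*:=-\left((-1)^\epsilon p\right)^p\left((-1)^\epsilon(p-1)\right)^{1-p}<0$ and, for each $a\in(a_*,0)$, $0<\beta<\alpha$ (depending on $a$ and $p$) denote the only two positive solutions $\kappa$ of $$f_{p,a}(\kappa):=a-\epsilon_2(p-1)^2\kappa^{2p}+\epsilon_2p^2\kappa^{2(p-1)}=0 .$$ *)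

theory Defs
  imports "HOL-Analysis.Analysis" "HOL-Real_Asymp.Real_Asymp"
begin

definition eps :: "real \<Rightarrow> nat" where
  "eps p = (if p > 1 then 0 else 1)"

definition eps2 :: "real \<Rightarrow> real" where
  "eps2 p = (-1) ^ eps p"

definition a_star :: "real \<Rightarrow> real" where
  "a_star p = - (((-1) ^ eps p * p) powr p * ((-1) ^ eps p * (p - 1)) powr (1 - p))"

definition fpa :: "real \<Rightarrow> real \<Rightarrow> real \<Rightarrow> real" where
  "fpa p a \<kappa> = a - eps2 p * (p - 1)\<^sup>2 * \<kappa> powr (2 * p) + eps2 p * p\<^sup>2 * \<kappa> powr (2 * (p - 1))"

definition two_zeros :: "real \<Rightarrow> real \<Rightarrow> real \<Rightarrow> real \<Rightarrow> bool" where
  "two_zeros p a b c \<longleftrightarrow> 0 < b \<and> b < c \<and> {\<kappa>. 0 < \<kappa> \<and> fpa p a \<kappa> = 0} = {b, c}"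

text \<open>The descriptions below are proper for every relevant \<open>p\<close> and \<open>a\<close>; see \<open>two_zeros_beta_alpha\<close>.\<close>

definition beta :: "real \<Rightarrow> real \<Rightarrow> real" where
  "beta p a = (THE b. \<exists>c. two_zeros p a b c)"

definition alpha :: "real \<Rightarrow> real \<Rightarrow> real" where
  "alpha p a = (THE c. \<exists>b. two_zeros p a b c)"

definition Lambda_integrand :: "real \<Rightarrow> real \<Rightarrow> real \<Rightarrow> real" where
  "Lambda_integrand p a \<kappa> =
     \<kappa> powr (2 * (p - 1)) /
       ((a + eps2 p * p\<^sup>2 * \<kappa> powr (2 * (p - 1))) *
        sqrt (a - eps2 p * (p - 1)\<^sup>2 * \<kappa> powr (2 * p) + eps2 p * p\<^sup>2 * \<kappa> powr (2 * (p - 1))))"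

text \<open>The radicand vanishes at both endpoints. The interval integral below is the Lebesgue
  integral over the open interval from \<open>beta p a\<close> to \<open>alpha p a\<close>; since the integrand has
  constant sign there, it coincides with the improper Riemann integral.\<close>

definition Lambda :: "real \<Rightarrow> real \<Rightarrow> real" where
  "Lambda p a = 2 * p * (p - 1)\<^sup>2 * sqrt (- a) *
     (LBINT \<kappa>=beta p a..alpha p a. Lambda_integrand p a \<kappa>)"

lemma a_star_neg:
  assumes "p < 0 \<or> p > 1"
  shows "a_star p < 0"
  using assms by (auto simp: a_star_def eps_def)

lemma fpa_factor:
  assumes "\<kappa> > 0"
  shows "fpa p a \<kappa> = a + eps2 p * \<kappa> powr (2 * (p - 1)) * (p\<^sup>2 - (p - 1)\<^sup>2 * \<kappa>\<^sup>2)"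
proof -
  have "\<kappa> powr (2 * p) = \<kappa> powr (2 * (p - 1) + 2)" by (simp add: algebra_simps)
  also have "\<dots> = \<kappa> powr (2 * (p - 1)) * \<kappa>\<^sup>2"
    using assms by (subst powr_add) simp
  finally show ?thesis by (simp add: fpa_def algebra_simps)
qed

lemma fpa_deriv:
  assumes "\<kappa> > 0"
  shows "(fpa p a has_real_derivative
    2 * p * (p - 1) * \<kappa> powr (2 * p - 3) * (eps2 p * (p - (p - 1) * \<kappa>\<^sup>2))) (at \<kappa>)"
proof -
  have e: "\<kappa> powr (2 * p - 1) = \<kappa> powr (2 * p - 3) * \<kappa>\<^sup>2"
  proof -
    have "\<kappa> powr (2 * p - 1) = \<kappa> powr ((2 * p - 3) + 2)" by (simp add: algebra_simps)
    also have "\<dots> = \<kappa> powr (2 * p - 3) * \<kappa>\<^sup>2"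
      using assms by (subst powr_add) simp
    finally show ?thesis .
  qed
  have e2: "2 * (p - 1) - 1 = 2 * p - 3" by simp
  have "(fpa p a has_real_derivative
    - (eps2 p * (p - 1)\<^sup>2 * ((2 * p) * \<kappa> powr (2 * p - 1)))
    + eps2 p * p\<^sup>2 * ((2 * (p - 1)) * \<kappa> powr (2 * (p - 1) - 1))) (at \<kappa>)"
    unfolding fpa_def using assms
    by (auto intro!: derivative_eq_intros)
  then show ?thesis
    unfolding e e2 by (rule back_subst[where P = "\<lambda>d. DERIV _ _ :> d"])
      (simp add: algebra_simps power2_eq_square)
qed

lemma fpa_peak:
  assumes p: "p < 0 \<or> p > 1"
  defines "k \<equiv> sqrt (p / (p - 1))"
  shows "k > 0" "fpa p a k = a - a_star p"
    and "\<And>x. 0 < x \<Longrightarrow> x < k \<Longrightarrow> 0 < eps2 p * (p - (p - 1) * x\<^sup>2)"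
    and "\<And>x. k < x \<Longrightarrow> eps2 p * (p - (p - 1) * x\<^sup>2) < 0"
proof -
  have q: "p / (p - 1) > 0" using p by (auto simp: divide_simps)
  show k0: "k > 0" unfolding k_def using q by simp
  have k2: "k\<^sup>2 = p / (p - 1)" unfolding k_def using q by simp
  have c: "p - (p - 1) * x\<^sup>2 = (p - 1) * (k\<^sup>2 - x\<^sup>2)" for x
    using p unfolding k2 by (auto simp: field_simps)
  have s: "eps2 p * (p - 1) > 0" using p by (auto simp: eps2_def eps_def)
  have c': "eps2 p * (p - (p - 1) * x\<^sup>2) = (eps2 p * (p - 1)) * (k\<^sup>2 - x\<^sup>2)" for x
    unfolding c by simp
  show "0 < eps2 p * (p - (p - 1) * x\<^sup>2)" if "0 < x" "x < k" for x
    unfolding c' using power_strict_mono[of x k 2] that by (intro mult_pos_pos[OF s]) simp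
  show "eps2 p * (p - (p - 1) * x\<^sup>2) < 0" if "k < x" for x
    unfolding c' using power_strict_mono[of k x 2] that k0 by (intro mult_pos_neg[OF s]) simp
  have kp: "k powr (2 * (p - 1)) = (p / (p - 1)) powr (p - 1)"
  proof -
    have "k powr (2 * (p - 1)) = (k powr 2) powr (p - 1)" by (simp add: powr_powr)
    also have "k powr 2 = p / (p - 1)" using k0 k2 by simp
    finally show ?thesis .
  qed
  have "fpa p a k = a + eps2 p * (p / (p - 1)) powr (p - 1) * (p\<^sup>2 - (p - 1)\<^sup>2 * (p / (p - 1)))"
    unfolding fpa_factor[OF k0] kp k2 ..
  also have "p\<^sup>2 - (p - 1)\<^sup>2 * (p / (p - 1)) = p"
    using p by (auto simp: field_simps power2_eq_square)
  also have "eps2 p * (p / (p - 1)) powr (p - 1) * p = - a_star p"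
  proof (cases "p > 1")
    case True
    have "p powr p = p powr (p - 1) * p" using True powr_add[of p "p - 1" 1] by simp
    moreover have "(p - 1) powr (1 - p) = inverse ((p - 1) powr (p - 1))"
      using powr_minus[of "p - 1" "p - 1"] by simp
    ultimately show ?thesis using True
      by (simp add: eps2_def eps_def a_star_def powr_divide field_simps)
  next
    case False
    then have n: "p < 0" using p by simp
    have "p / (p - 1) = (- p) / (1 - p)" using n by (simp add: field_simps)
    then have "(p / (p - 1)) powr (p - 1) = (- p) powr (p - 1) / (1 - p) powr (p - 1)"
      using n powr_divide[of "- p" "1 - p" "p - 1"] by simp
    moreover have "(- p) powr p = (- p) powr (p - 1) * (- p)"
      using n powr_add[of "- p" "p - 1" 1] by simp
    moreover have "(1 - p) powr (1 - p) = inverse ((1 - p) powr (p - 1))"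
      using powr_minus[of "1 - p" "p - 1"] by simp
    moreover have "eps2 p = - 1" "a_star p = - ((- p) powr p * (1 - p) powr (1 - p))"
      using n by (simp_all add: eps2_def eps_def a_star_def)
    ultimately show ?thesis
      by (simp only: divide_inverse) (simp only: minus_minus mult_minus_left mult_minus_right mult_1_left mult.assoc mult.commute mult.left_commute)
  qed
  finally show "fpa p a k = a - a_star p" by simp
qed

lemma ex_fpa_neg_left:
  assumes p: "p < 0 \<or> p > 1" and a: "a < 0" and k: "k > 0"
  shows "\<exists>x. 0 < x \<and> x < k \<and> fpa p a x < 0"
proof -
  have "eventually (\<lambda>x. fpa p a x < 0) (at_right 0)"
  proof (cases "p > 1")
    case True
    have "(fpa p a \<longlongrightarrow> a) (at_right 0)"
      unfolding fpa_def using True by real_asymp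
    then show ?thesis using a by (rule order_tendstoD)
  next
    case False
    then have "p < 0" using p by simp
    then have "LIM x at_right 0. x powr (2 * (p - 1)) * (p\<^sup>2 - (p - 1)\<^sup>2 * x\<^sup>2) :> at_top"
      by real_asymp
    then have "eventually (\<lambda>x. x powr (2 * (p - 1)) * (p\<^sup>2 - (p - 1)\<^sup>2 * x\<^sup>2) > 0) (at_right 0)"
      by (simp add: filterlim_at_top_dense)
    moreover have "eventually (\<lambda>x::real. x > 0) (at_right 0)" by (rule eventually_at_right_less)
    ultimately show ?thesis
      by eventually_elim (use \<open>p < 0\<close> a in \<open>auto simp: fpa_factor eps2_def eps_def\<close>)
  qed
  moreover have "eventually (\<lambda>x. x \<in> {0<..<k}) (at_right 0)"
    using k by (rule eventually_at_right_real)
  ultimately have "eventually (\<lambda>x. 0 < x \<and> x < k \<and> fpa p a x < 0) (at_right 0)"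
    by eventually_elim auto
  then show ?thesis
    by (rule eventually_happens'[OF trivial_limit_at_right_real])
qed

lemma ex_fpa_neg_right:
  assumes p: "p < 0 \<or> p > 1" and a: "a < 0"
  shows "\<exists>x>k. fpa p a x < 0"
proof -
  have "eventually (\<lambda>x. fpa p a x < 0) at_top"
  proof (cases "p > 1")
    case True
    then have "LIM x at_top. x powr (2 * (p - 1)) * (p\<^sup>2 - (p - 1)\<^sup>2 * x\<^sup>2) :> at_bot"
      by real_asymp
    then have "eventually (\<lambda>x. x powr (2 * (p - 1)) * (p\<^sup>2 - (p - 1)\<^sup>2 * x\<^sup>2) < 0) at_top"
      by (simp add: filterlim_at_bot_dense)
    moreover have "eventually (\<lambda>x::real. x > 0) at_top" by (rule eventually_gt_at_top)
    ultimately show ?thesis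
      by eventually_elim (use True a in \<open>auto simp: fpa_factor eps2_def eps_def\<close>)
  next
    case False
    then have "p < 0" using p by simp
    then have "(fpa p a \<longlongrightarrow> a) at_top"
      unfolding fpa_def by real_asymp
    then show ?thesis using a by (rule order_tendstoD)
  qed
  moreover have "eventually (\<lambda>x. x > k) at_top" by (rule eventually_gt_at_top)
  ultimately have "eventually (\<lambda>x. k < x \<and> fpa p a x < 0) at_top"
    by eventually_elim auto
  then show ?thesis
    by (rule eventually_happens'[OF trivial_limit_at_top_linorder])
qed

lemma ex_two_zeros:
  assumes p: "p < 0 \<or> p > 1" and a: "a_star p < a" "a < 0"
  shows "\<exists>b c. two_zeros p a b c"
proof -
  define k where "k = sqrt (p / (p - 1))"
  note pk = fpa_peak[OF p, folded k_def]
  have k: "k > 0" by (rule pk)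
  have fk: "fpa p a k > 0" using pk(2)[of a] a by simp
  have pp: "2 * p * (p - 1) > 0" using p by (auto simp: zero_less_mult_iff)
  have cont: "isCont (fpa p a) x" if "x > 0" for x
    using fpa_deriv[OF that] by (rule DERIV_isCont)
  have contI: "continuous_on {x..y} (fpa p a)" if "x > 0" for x y
    using that cont by (intro continuous_at_imp_continuous_on) auto
  have inc: "fpa p a x < fpa p a y" if "0 < x" "x < y" "y \<le> k" for x y
  proof (rule DERIV_pos_imp_increasing_open[OF \<open>x < y\<close>])
    fix z assume z: "x < z" "z < y"
    then have z0: "0 < z" "z < k" using that by auto
    show "\<exists>d. DERIV (fpa p a) z :> d \<and> d > 0"
      by (intro exI conjI, rule fpa_deriv[OF z0(1)])
        (rule mult_pos_pos[OF mult_pos_pos[OF pp] pk(3)[OF z0]], use z0 in simp)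
  qed (use contI that in auto)
  have dec: "fpa p a y < fpa p a x" if "k \<le> x" "x < y" for x y
  proof (rule DERIV_neg_imp_decreasing_open[OF \<open>x < y\<close>])
    fix z assume z: "x < z" "z < y"
    then have z0: "0 < z" "k < z" using that k by auto
    show "\<exists>d. DERIV (fpa p a) z :> d \<and> d < 0"
      by (intro exI conjI, rule fpa_deriv[OF z0(1)])
        (rule mult_pos_neg[OF mult_pos_pos[OF pp] pk(4)[OF z0(2)]], use z0 in simp)
  qed (use contI that k in auto)
  obtain l where l: "0 < l" "l < k" "fpa p a l < 0" using ex_fpa_neg_left[OF p a(2) k] by blast
  obtain r where r: "k < r" "fpa p a r < 0" using ex_fpa_neg_right[OF p a(2)] by blast
  obtain b where b: "l \<le> b" "b \<le> k" "fpa p a b = 0"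
    using IVT'[of "fpa p a" l 0 k] l fk contI by force
  obtain c where c: "k \<le> c" "c \<le> r" "fpa p a c = 0"
    using IVT2'[of "fpa p a" r 0 k] r fk contI k by force
  have bc: "0 < b" "b < k" "k < c"
    using b c l fk by (auto simp: less_le)
  have "x = b \<or> x = c" if "0 < x" "fpa p a x = 0" for x
  proof (cases "x \<le> k")
    case True
    then show ?thesis
      using inc[of x b] inc[of b x] that b bc by (cases x b rule: linorder_cases) auto
  next
    case False
    then show ?thesis
      using dec[of x c] dec[of c x] that c bc by (cases x c rule: linorder_cases) auto
  qed
  then have "two_zeros p a b c"
    unfolding two_zeros_def using b c bc by auto
  then show ?thesis by blast
qed

lemma two_zeros_unique:
  assumes "two_zeros p a b c" "two_zeros p a b' c'"
  shows "b = b' \<and> c = c'"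
proof -
  have "{b, c} = {b', c'}" "b < c" "b' < c'" using assms by (auto simp: two_zeros_def)
  then show ?thesis by (auto simp: doubleton_eq_iff)
qed

lemma two_zeros_beta_alpha:
  assumes "p < 0 \<or> p > 1" "a_star p < a" "a < 0"
  shows "two_zeros p a (beta p a) (alpha p a)"
proof -
  obtain b c where bc: "two_zeros p a b c" using ex_two_zeros[OF assms] by blast
  have "beta p a = b" unfolding beta_def
    by (rule the_equality) (use bc two_zeros_unique in blast)+
  moreover have "alpha p a = c" unfolding alpha_def
    by (rule the_equality) (use bc two_zeros_unique in blast)+
  ultimately show ?thesis using bc by simp
qed

end

theory Submission
  imports Defs
begin

text \<open>
  Both singularities of the integrand are removed by one change of variables, after which continuity
  and the limit are instances of the continuity of a parameter integral over a fixed compact interval.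

  Write \<open>k = sqrt (p / (p - 1))\<close> for the critical point of \<open>fpa p a\<close> and \<open>w = - fpa p (a_star p)\<close>, so that
  \<open>fpa p a x = (a - a_star p) - w x\<close> with \<open>w \<ge> 0\<close> vanishing exactly at \<open>k\<close>. Since
  \<open>w' x = 2 * (x - k) * curv p x\<close> with \<open>curv p\<close> positive, Cauchy's mean value theorem gives
  \<open>w x = (x - k)\<^sup>2 * curv p \<xi>\<close> for some \<open>\<xi>\<close> between \<open>x\<close> and \<open>k\<close> (\<open>defect_quot_eq_curv\<close>). Hence
  \<open>w / (x - k)\<^sup>2\<close> extends to a positive continuous function, and \<open>w\<close> is the square of a function
  \<open>phase p\<close>, \<open>C\<^sup>1\<close> with positive derivative even at \<open>k\<close>. In the coordinate \<open>y = phase p x\<close> the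
  radicand is \<open>c\<^sup>2 - y\<^sup>2\<close> with \<open>c = sqrt (a - a_star p)\<close>, and the zeros \<open>beta p a\<close>, \<open>alpha p a\<close>
  become \<open>-c\<close> and \<open>c\<close>.

  Putting \<open>y = c * sin \<theta>\<close> turns \<open>dy / sqrt (c\<^sup>2 - y\<^sup>2)\<close> into \<open>d\<theta>\<close> (\<open>arcsine_substitution\<close>). What remains is
  an integral over \<open>- pi/2 \<le> \<theta> \<le> pi/2\<close> of a function jointly continuous in \<open>\<theta>\<close> and \<open>a\<close>, and this
  includes \<open>a = a_star p\<close>, where \<open>c = 0\<close>. The resulting function \<open>Lambda_arc p\<close> is therefore continuous
  on \<open>a_star p \<le> a < 0\<close> and agrees with \<open>Lambda p\<close> on the open interval. At \<open>a_star p\<close> its integrand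
  is constant, and the second-order data of \<open>w\<close> at \<open>k\<close> give the value \<open>sqrt 2 * pi\<close>.
\<close>

section \<open>The arcsine substitution along an inverse square root singularity\<close>

text \<open>
  With \<open>x = \<psi> (c * sin \<theta>)\<close> the factor \<open>c * cos \<theta>\<close> in \<open>dx/d\<theta>\<close> cancels against
  \<open>sqrt (R x) = c * cos \<theta>\<close>, leaving a continuous integrand in \<open>\<theta>\<close>. Nonnegativity of \<open>N\<close> and \<open>\<psi>'\<close>
  lets integrability be transported back to \<open>x\<close>, where the integrand may be unbounded.
\<close>

lemma arcsine_substitution:
  fixes \<psi> \<psi>' N R :: "real \<Rightarrow> real"
  assumes c: "0 < c"
    and deriv: "\<And>y. y \<in> {-c..c} \<Longrightarrow> (\<psi> has_real_derivative \<psi>' y) (at y)"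
    and cont': "continuous_on {-c..c} \<psi>'"
    and nonneg': "\<And>y. y \<in> {-c..c} \<Longrightarrow> 0 \<le> \<psi>' y"
    and contN: "\<And>y. y \<in> {-c..c} \<Longrightarrow> isCont N (\<psi> y)"
    and nonnegN: "\<And>y. y \<in> {-c..c} \<Longrightarrow> 0 \<le> N (\<psi> y)"
    and contR: "\<And>y. y \<in> {-c..c} \<Longrightarrow> isCont R (\<psi> y)"
    and R: "\<And>y. y \<in> {-c..c} \<Longrightarrow> R (\<psi> y) = c\<^sup>2 - y\<^sup>2"
  shows "interval_lebesgue_integrable lborel (\<psi> (-c)) (\<psi> c) (\<lambda>x. N x / sqrt (R x))" (is ?int)
    and "(LBINT x=\<psi> (-c)..\<psi> c. N x / sqrt (R x)) =
      integral {-(pi/2)..pi/2} (\<lambda>\<theta>. N (\<psi> (c * sin \<theta>)) * \<psi>' (c * sin \<theta>))" (is ?eq)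
proof -
  define g where "g \<theta> = \<psi> (c * sin \<theta>)" for \<theta>
  define g' where "g' \<theta> = \<psi>' (c * sin \<theta>) * (c * cos \<theta>)" for \<theta>
  define f where "f x = N x / sqrt (R x)" for x
  define F where "F \<theta> = N (\<psi> (c * sin \<theta>)) * \<psi>' (c * sin \<theta>)" for \<theta>
  have mem: "c * sin \<theta> \<in> {-c..c}" for \<theta>
    using c mult_left_mono[of "sin \<theta>" 1 c] mult_left_mono[of "-1" "sin \<theta>" c] by auto
  have cos_pos: "0 < cos \<theta>" if "-(pi/2) < \<theta>" "\<theta> < pi/2" for \<theta>
    using that by (rule cos_gt_zero_pi)
  have inner: "c * sin \<theta> \<in> {-c<..<c}" if "-(pi/2) < \<theta>" "\<theta> < pi/2" for \<theta>
  proof -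
    have "(sin \<theta>)\<^sup>2 < 1"
      using cos_pos[OF that] sin_cos_squared_add[of \<theta>] zero_less_power[of "cos \<theta>" 2] by linarith
    then have "\<bar>sin \<theta>\<bar> < 1" by (simp add: abs_square_less_1)
    then have "sin \<theta> < 1" "-1 < sin \<theta>" by auto
    then show ?thesis
      using c mult_strict_left_mono[of "sin \<theta>" 1 c] mult_strict_left_mono[of "-1" "sin \<theta>" c] by simp
  qed
  have root: "sqrt (R (g \<theta>)) = c * \<bar>cos \<theta>\<bar>" for \<theta>
  proof -
    have "R (g \<theta>) = (c * cos \<theta>)\<^sup>2"
      unfolding g_def R[OF mem] by (simp add: power_mult_distrib cos_squared_eq algebra_simps)
    then show ?thesis using c by (simp add: abs_mult)
  qed
  have cont\<psi>: "isCont \<psi> y" if "y \<in> {-c..c}" for y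
    using deriv[OF that] by (rule DERIV_isCont)
  have contg: "isCont g \<theta>" for \<theta>
    unfolding g_def by (rule isCont_o2[where g = \<psi>]) (intro continuous_intros, rule cont\<psi>[OF mem])
  have contF: "continuous_on {-(pi/2)..pi/2} F"
  proof -
    have "continuous_on {-(pi/2)..pi/2} (\<lambda>\<theta>. N (g \<theta>))"
      using contN[OF mem]
      by (intro continuous_at_imp_continuous_on ballI isCont_o2[OF contg]) (simp add: g_def[symmetric])
    moreover have "continuous_on {-(pi/2)..pi/2} (\<lambda>\<theta>. \<psi>' (c * sin \<theta>))"
      by (rule continuous_on_compose2[OF cont']) (use mem in \<open>auto intro!: continuous_intros\<close>)
    ultimately show ?thesis unfolding F_def g_def by (rule continuous_on_mult)
  qed
  have intF: "set_integrable lborel {-(pi/2)..pi/2} F"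
    by (rule borel_integrable_atLeastAtMost') (rule contF)
  have fg: "f (g \<theta>) * g' \<theta> = F \<theta>" if "-(pi/2) < \<theta>" "\<theta> < pi/2" for \<theta>
    using cos_pos[OF that] c by (simp add: f_def root g'_def F_def) (simp add: g_def)
  have intF': "set_integrable lborel {-(pi/2)<..<pi/2} F"
    by (rule set_integrable_subset[OF intF]) auto
  have int: "set_integrable lborel (einterval (ereal (-(pi/2))) (ereal (pi/2))) (\<lambda>\<theta>. f (g \<theta>) * g' \<theta>)"
    using intF' by (subst set_integrable_cong[OF refl refl, where f' = F]) (auto simp: fg)
  have lim: "((ereal \<circ> g \<circ> real_of_ereal) \<longlongrightarrow> ereal (g \<theta>)) (at_left (ereal \<theta>))"
    "((ereal \<circ> g \<circ> real_of_ereal) \<longlongrightarrow> ereal (g \<theta>)) (at_right (ereal \<theta>))" for \<theta>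
    using contg[of \<theta>] unfolding isCont_def ereal_tendsto_simps1 ereal_tendsto_simps2
    by (simp_all add: filterlim_at_split)
  have ends: "g (-(pi/2)) = \<psi> (-c)" "g (pi/2) = \<psi> c" by (simp_all add: g_def)
  have sub: "set_integrable lborel (einterval (\<psi> (-c)) (\<psi> c)) f"
    "(LBINT x=\<psi> (-c)..\<psi> c. f x) = (LBINT \<theta>=-(pi/2)..pi/2. f (g \<theta>) * g' \<theta>)"
  proof -
    have *: "ereal (-(pi/2)) < ereal (pi/2)" by simp
    have 1: "DERIV g \<theta> :> g' \<theta>" if "ereal (-(pi/2)) < ereal \<theta>" "ereal \<theta> < ereal (pi/2)" for \<theta>
      unfolding g_def g'_def
      by (rule DERIV_chain2[where f = \<psi>], rule deriv[OF mem]) (auto intro!: derivative_eq_intros)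
    \<comment> \<open>The radicand vanishes at the images of \<open>\<theta> = -pi/2\<close> and \<open>\<theta> = pi/2\<close>, where \<open>f\<close> may fail to be continuous.\<close>
    have 2: "isCont f (g \<theta>)" if "ereal (-(pi/2)) < ereal \<theta>" "ereal \<theta> < ereal (pi/2)" for \<theta>
    proof -
      have "sqrt (R (g \<theta>)) \<noteq> 0" using cos_pos[of \<theta>] that c by (simp add: root)
      then show ?thesis
        unfolding f_def using contN[OF mem] contR[OF mem] by (auto simp: g_def intro!: continuous_intros)
    qed
    have 3: "isCont g' \<theta>" if "ereal (-(pi/2)) < ereal \<theta>" "ereal \<theta> < ereal (pi/2)" for \<theta>
    proof -
      have "isCont \<psi>' (c * sin \<theta>)"
        using continuous_on_interior[OF cont'] inner[of \<theta>] that by (simp add: interior_atLeastAtMost_real)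
      then have "isCont (\<lambda>\<theta>. \<psi>' (c * sin \<theta>)) \<theta>"
        by (rule isCont_o2[where g = \<psi>', rotated]) (intro continuous_intros)
      then show ?thesis unfolding g'_def by (intro continuous_intros)
    qed
    have 4: "0 \<le> f (g \<theta>)" for \<theta>
      using nonnegN[OF mem, of \<theta>] c by (simp add: f_def root) (simp add: g_def)
    have 5: "0 \<le> g' \<theta>" if "ereal (-(pi/2)) \<le> ereal \<theta>" "ereal \<theta> \<le> ereal (pi/2)" for \<theta>
      unfolding g'_def using that c nonneg'[OF mem] by (intro mult_nonneg_nonneg cos_ge_zero) auto
    note S = interval_integral_substitution_nonneg[OF * 1 2 3 4 5 lim(2) lim(1) int, unfolded ends]
    show "set_integrable lborel (einterval (\<psi> (-c)) (\<psi> c)) f"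
      "(LBINT x=\<psi> (-c)..\<psi> c. f x) = (LBINT \<theta>=-(pi/2)..pi/2. f (g \<theta>) * g' \<theta>)"
      by (rule S; assumption)+
  qed
  have "\<psi> (-c) \<le> \<psi> c"
    using DERIV_nonneg_imp_nondecreasing[of "-c" c \<psi>] c deriv nonneg' by force
  then show ?int using sub(1) by (simp add: interval_lebesgue_integrable_def f_def[abs_def])
  have "(LBINT \<theta>=-(pi/2)..pi/2. f (g \<theta>) * g' \<theta>) = (LBINT \<theta>=-(pi/2)..pi/2. F \<theta>)"
    by (rule interval_integral_cong) (use fg in \<open>auto simp: min_def max_def\<close>)
  also have "\<dots> = integral {-(pi/2)..pi/2} F"
    by (rule interval_integral_eq_integral[OF _ intF]) simp
  finally show ?eq using sub(2) by (simp add: f_def[abs_def] F_def[abs_def])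
qed

section \<open>A coordinate in which the radicand is quadratic\<close>

definition crit :: "real \<Rightarrow> real" where
  "crit p = sqrt (p / (p - 1))"

definition defect :: "real \<Rightarrow> real \<Rightarrow> real" where
  "defect p x = - fpa p (a_star p) x"

text \<open>Half of the derivative of \<open>defect p\<close>, divided by \<open>x - crit p\<close>; at \<open>crit p\<close> this is half of the second derivative.\<close>

definition curv :: "real \<Rightarrow> real \<Rightarrow> real" where
  "curv p x = eps2 p * p * (p - 1)\<^sup>2 * x powr (2 * p - 3) * (x + crit p)"

definition defect_quot :: "real \<Rightarrow> real \<Rightarrow> real" where
  "defect_quot p x = (if x = crit p then curv p x else defect p x / (x - crit p)\<^sup>2)"

text \<open>The square root of \<open>defect p\<close> carrying the sign of \<open>x - crit p\<close>, written as a product so that it is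
  visibly differentiable at \<open>crit p\<close>.\<close>

definition phase :: "real \<Rightarrow> real \<Rightarrow> real" where
  "phase p x = (x - crit p) * sqrt (defect_quot p x)"

definition phase_inv :: "real \<Rightarrow> real \<Rightarrow> real" where
  "phase_inv p = the_inv_into {0<..} (phase p)"

text \<open>The reciprocal of the derivative of \<open>phase p\<close> at the preimage of \<open>y\<close>; see \<open>phase_deriv\<close>.\<close>

definition phase_inv' :: "real \<Rightarrow> real \<Rightarrow> real" where
  "phase_inv' p y = sqrt (defect_quot p (phase_inv p y)) / curv p (phase_inv p y)"

lemma eps2_squared: "eps2 p * eps2 p = 1"
  by (auto simp: eps2_def eps_def)

lemma fpa_eq_defect: "fpa p a x = (a - a_star p) - defect p x"
  by (simp add: defect_def fpa_def)

context
  fixes p :: real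
  assumes p: "p < 0 \<or> p > 1"
begin

lemma eps2_mult_p_pos: "0 < eps2 p * p"
  using p by (auto simp: eps2_def eps_def)

lemma crit_pos: "0 < crit p"
  using fpa_peak(1)[OF p] by (simp add: crit_def)

lemma crit_squared: "(p - 1) * (crit p)\<^sup>2 = p"
proof -
  have "0 < p / (p - 1)" using p by (auto simp: zero_less_divide_iff)
  then show ?thesis using p by (auto simp: crit_def)
qed

lemma curv_pos: "0 < x \<Longrightarrow> 0 < curv p x"
  using p crit_pos mult_pos_pos[OF eps2_mult_p_pos, of "(p - 1)\<^sup>2 * x powr (2 * p - 3) * (x + crit p)"]
  by (auto simp: curv_def mult.assoc)

lemma isCont_curv: "0 < x \<Longrightarrow> isCont (curv p) x"
  unfolding curv_def by (intro continuous_intros) auto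

lemma defect_crit: "defect p (crit p) = 0"
  using fpa_peak(2)[OF p, of "a_star p"] by (simp add: defect_def crit_def)

lemma defect_deriv:
  assumes "0 < x"
  shows "(defect p has_real_derivative 2 * (x - crit p) * curv p x) (at x)"
proof -
  have c: "p - (p - 1) * x\<^sup>2 = (p - 1) * ((crit p)\<^sup>2 - x\<^sup>2)"
    using crit_squared by (simp add: algebra_simps)
  have "(defect p has_real_derivative
      - (2 * p * (p - 1) * x powr (2 * p - 3) * (eps2 p * (p - (p - 1) * x\<^sup>2)))) (at x)"
    unfolding defect_def[abs_def] by (intro DERIV_minus fpa_deriv assms)
  then show ?thesis
    unfolding c curv_def
    by (rule back_subst[where P = "\<lambda>d. DERIV _ _ :> d"]) (simp add: power2_eq_square algebra_simps)
qed

lemma isCont_defect: "0 < x \<Longrightarrow> isCont (defect p) x"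
  using defect_deriv by (rule DERIV_isCont)

text \<open>
  Cauchy's mean value theorem for \<open>defect p\<close> and \<open>(x - crit p)\<^sup>2\<close>, which both vanish at \<open>crit p\<close>: the
  quotient of the derivatives is \<open>curv p\<close>. This yields the positivity of the quotient everywhere
  and its continuity at \<open>crit p\<close>.
\<close>

lemma defect_quot_eq_curv:
  assumes "0 < x"
  shows "\<exists>\<xi>>0. \<bar>\<xi> - crit p\<bar> \<le> \<bar>x - crit p\<bar> \<and> defect_quot p x = curv p \<xi>"
proof -
  let ?k = "crit p"
  have d2: "((\<lambda>x. (x - ?k)\<^sup>2) has_real_derivative 2 * (z - ?k)) (at z)" for z
    by (auto intro!: derivative_eq_intros)
  have c2: "isCont (\<lambda>x. (x - ?k)\<^sup>2) z" for z
    by (intro continuous_intros)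
  have step: ?thesis
    if "0 < \<xi>" "\<bar>\<xi> - ?k\<bar> \<le> \<bar>x - ?k\<bar>" "\<xi> \<noteq> ?k" "x \<noteq> ?k"
      "defect p x * (2 * (\<xi> - ?k)) = (x - ?k)\<^sup>2 * (2 * (\<xi> - ?k) * curv p \<xi>)" for \<xi>
  proof -
    have "defect p x = (x - ?k)\<^sup>2 * curv p \<xi>"
      using that(3,5) by simp
    then show ?thesis using that by (intro exI[of _ \<xi>]) (simp add: defect_quot_def)
  qed
  consider "x < ?k" | "x = ?k" | "?k < x" by linarith
  then show ?thesis
  proof cases
    case 1
    obtain \<xi> where "x < \<xi>" "\<xi> < ?k" "(defect p ?k - defect p x) * (2 * (\<xi> - ?k)) =
        ((?k - ?k)\<^sup>2 - (x - ?k)\<^sup>2) * (2 * (\<xi> - ?k) * curv p \<xi>)"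
      using GMVT'[OF 1, of "defect p" "\<lambda>x. (x - ?k)\<^sup>2" "\<lambda>z. 2 * (z - ?k)"
          "\<lambda>z. 2 * (z - ?k) * curv p z"] isCont_defect defect_deriv d2 c2 assms
      by auto
    then show ?thesis by (intro step[of \<xi>]) (use assms defect_crit in auto)
  next
    case 2
    then show ?thesis using assms by (intro exI[of _ x]) (simp add: defect_quot_def)
  next
    case 3
    obtain \<xi> where "?k < \<xi>" "\<xi> < x" "(defect p x - defect p ?k) * (2 * (\<xi> - ?k)) =
        ((x - ?k)\<^sup>2 - (?k - ?k)\<^sup>2) * (2 * (\<xi> - ?k) * curv p \<xi>)"
      using GMVT'[OF 3, of "defect p" "\<lambda>x. (x - ?k)\<^sup>2" "\<lambda>z. 2 * (z - ?k)"
          "\<lambda>z. 2 * (z - ?k) * curv p z"] isCont_defect defect_deriv d2 c2 crit_pos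
      by auto
    then show ?thesis by (intro step[of \<xi>]) (use assms defect_crit crit_pos in auto)
  qed
qed

lemma defect_quot_pos: "0 < x \<Longrightarrow> 0 < defect_quot p x"
  using defect_quot_eq_curv curv_pos by metis

lemma isCont_defect_quot:
  assumes x: "0 < x"
  shows "isCont (defect_quot p) x"
proof (cases "x = crit p")
  case False
  have "isCont (\<lambda>z. defect p z / (z - crit p)\<^sup>2) x"
    using False isCont_defect[OF x] by (intro continuous_intros) auto
  moreover have "\<forall>\<^sub>F z in nhds x. defect p z / (z - crit p)\<^sup>2 = defect_quot p z"
    using t1_space_nhds[OF False] by eventually_elim (simp add: defect_quot_def)
  ultimately show ?thesis using isCont_cong[of "\<lambda>z. defect p z / (z - crit p)\<^sup>2" "defect_quot p"] by blast
next
  case True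
  show ?thesis unfolding True continuous_at_eps_delta
  proof (intro allI impI)
    fix e :: real assume "0 < e"
    then obtain d where d: "d > 0"
      "\<And>z. \<bar>z - crit p\<bar> < d \<Longrightarrow> \<bar>curv p z - curv p (crit p)\<bar> < e"
      using isCont_curv[OF crit_pos] unfolding continuous_at_eps_delta dist_real_def by meson
    have "\<bar>defect_quot p z - defect_quot p (crit p)\<bar> < e" if "\<bar>z - crit p\<bar> < min d (crit p)" for z
    proof -
      have "0 < z" using that by auto
      then obtain \<xi> where "\<bar>\<xi> - crit p\<bar> \<le> \<bar>z - crit p\<bar>" "defect_quot p z = curv p \<xi>"
        using defect_quot_eq_curv by blast
      then show ?thesis using d(2)[of \<xi>] that by (simp add: defect_quot_def[of p "crit p"])
    qed
    then show "\<exists>d>0. \<forall>z. dist z (crit p) < d \<longrightarrow> dist (defect_quot p z) (defect_quot p (crit p)) < e"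
      using d(1) crit_pos unfolding dist_real_def by (intro exI[of _ "min d (crit p)"]) auto
  qed
qed

lemma phase_squared:
  assumes "0 < x"
  shows "(phase p x)\<^sup>2 = defect p x"
  using defect_quot_pos[OF assms]
  by (auto simp: phase_def power_mult_distrib defect_quot_def defect_crit split: if_splits)

text \<open>
  Away from \<open>crit p\<close> this is the quotient and chain rule. At \<open>crit p\<close> the difference quotient of
  \<open>phase p\<close> is the continuous function \<open>sqrt (defect_quot p z)\<close> itself; as \<open>defect_quot p = curv p\<close>
  there, its value fits the same formula, so that the derivative is continuous across \<open>crit p\<close>.
\<close>

lemma phase_deriv:
  assumes x: "0 < x"
  shows "(phase p has_real_derivative curv p x / sqrt (defect_quot p x)) (at x)"
proof (cases "x = crit p")
  case True
  have "isCont (\<lambda>z. sqrt (defect_quot p z)) x"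
    using isCont_defect_quot[OF x] by (intro continuous_intros)
  moreover have "curv p x / sqrt (defect_quot p x) = sqrt (defect_quot p x)"
    using True curv_pos[OF x] by (simp add: defect_quot_def real_div_sqrt)
  ultimately show ?thesis
    unfolding CARAT_DERIV True by (intro exI[of _ "\<lambda>z. sqrt (defect_quot p z)"]) (simp add: phase_def)
next
  case False
  let ?k = "crit p"
  have S: "0 < sqrt (defect_quot p x)" using defect_quot_pos[OF x] by simp
  have Q: "((\<lambda>z. defect p z / (z - ?k)\<^sup>2) has_real_derivative
      (2 * (x - ?k) * curv p x * (x - ?k)\<^sup>2 - defect p x * (2 * (x - ?k))) / ((x - ?k)\<^sup>2 * (x - ?k)\<^sup>2)) (at x)"
    using False by (auto intro!: derivative_eq_intros defect_deriv[OF x])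
  have eq: "defect p x / (x - ?k)\<^sup>2 = defect_quot p x"
    using False by (simp add: defect_quot_def)
  have pos: "0 < defect p x / (x - ?k)\<^sup>2" unfolding eq by (rule defect_quot_pos[OF x])
  have D: "defect p x = (sqrt (defect_quot p x))\<^sup>2 * (x - ?k)\<^sup>2"
    using False defect_quot_pos[OF x] by (simp add: eq[symmetric])
  \<comment> \<open>The product rule with \<open>d = x - crit p\<close>, \<open>C = curv p x\<close> and \<open>S\<^sup>2 = defect p x / d\<^sup>2\<close>.\<close>
  have alg: "1 * S + inverse S / 2 * ((2 * d * C * d\<^sup>2 - S\<^sup>2 * d\<^sup>2 * (2 * d)) / (d\<^sup>2 * d\<^sup>2)) * d = C / S"
    if "0 < S" "d \<noteq> 0" for S C d :: real
    using that by (simp add: field_simps power2_eq_square)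
  have "((\<lambda>z. (z - ?k) * sqrt (defect p z / (z - ?k)\<^sup>2)) has_real_derivative
      1 * sqrt (defect_quot p x) + inverse (sqrt (defect_quot p x)) / 2 *
        ((2 * (x - ?k) * curv p x * (x - ?k)\<^sup>2 - defect p x * (2 * (x - ?k))) /
          ((x - ?k)\<^sup>2 * (x - ?k)\<^sup>2)) * (x - ?k)) (at x)"
    using DERIV_mult[OF _ DERIV_chain2[OF DERIV_real_sqrt[OF pos] Q], of "\<lambda>z. z - ?k" 1]
    unfolding eq by (rule meta_mp) (auto intro!: derivative_eq_intros)
  then have "((\<lambda>z. (z - ?k) * sqrt (defect p z / (z - ?k)\<^sup>2)) has_real_derivative
      curv p x / sqrt (defect_quot p x)) (at x)"
    using alg[OF S, of "x - ?k"] False by (simp flip: D)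
  moreover have "\<forall>\<^sub>F z in nhds x. (z - ?k) * sqrt (defect p z / (z - ?k)\<^sup>2) = phase p z"
    using t1_space_nhds[OF False] by eventually_elim (simp add: phase_def defect_quot_def)
  ultimately show ?thesis by (rule iffD1[OF DERIV_cong_ev[OF refl _ refl], rotated])
qed

lemma phase_less:
  assumes "0 < x" "x < y"
  shows "phase p x < phase p y"
proof (rule DERIV_pos_imp_increasing[OF assms(2)])
  fix z assume "x \<le> z" "z \<le> y"
  then have z: "0 < z" using assms by simp
  show "\<exists>d. DERIV (phase p) z :> d \<and> 0 < d"
    using phase_deriv[OF z] curv_pos[OF z] defect_quot_pos[OF z] by auto
qed

lemma phase_inj: "inj_on (phase p) {0<..}"
  by (rule linorder_inj_onI) (use phase_less in \<open>force+\<close>)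

lemma phase_inv_phase: "0 < x \<Longrightarrow> phase_inv p (phase p x) = x"
  unfolding phase_inv_def by (rule the_inv_into_f_f[OF phase_inj]) simp

text \<open>Both zeros have \<open>(phase p x)\<^sup>2 = a - a_star p\<close>; strict monotonicity decides the signs.\<close>

lemma phase_endpoints:
  assumes a: "a_star p < a" "a < 0"
  shows "0 < beta p a" "0 < alpha p a"
    and "phase p (beta p a) = - sqrt (a - a_star p)"
    and "phase p (alpha p a) = sqrt (a - a_star p)"
proof -
  have z: "two_zeros p a (beta p a) (alpha p a)" by (rule two_zeros_beta_alpha[OF p a])
  then show pos: "0 < beta p a" "0 < alpha p a" by (auto simp: two_zeros_def)
  have "fpa p a (beta p a) = 0" "fpa p a (alpha p a) = 0"
    using z by (auto simp: two_zeros_def set_eq_iff)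
  then have "(phase p (beta p a))\<^sup>2 = (sqrt (a - a_star p))\<^sup>2"
    "(phase p (alpha p a))\<^sup>2 = (sqrt (a - a_star p))\<^sup>2"
    using a pos by (simp_all add: fpa_eq_defect phase_squared)
  moreover have "phase p (beta p a) < phase p (alpha p a)"
    using z by (intro phase_less) (auto simp: two_zeros_def)
  ultimately show "phase p (beta p a) = - sqrt (a - a_star p)"
    "phase p (alpha p a) = sqrt (a - a_star p)"
    using a unfolding power2_eq_iff by auto
qed

text \<open>Every nonzero value is taken at a zero of \<open>fpa p a\<close> for \<open>a = a_star p + y\<^sup>2\<close>. The bound on \<open>y\<close>
  says that this \<open>a\<close> is negative, which is what makes the two zeros exist.\<close>

lemma phase_onto:
  assumes y: "y\<^sup>2 < - a_star p"
  shows "\<exists>x>0. phase p x = y"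
proof (cases "y = 0")
  case True
  then show ?thesis using crit_pos by (intro exI[of _ "crit p"]) (simp add: phase_def)
next
  case False
  define a where "a = a_star p + y\<^sup>2"
  have a: "a_star p < a" "a < 0" using y False by (auto simp: a_def)
  have "sqrt (a - a_star p) = \<bar>y\<bar>" by (simp add: a_def)
  then show ?thesis using phase_endpoints[OF a] by (cases "0 \<le> y") force+
qed

lemma phase_phase_inv:
  assumes "y\<^sup>2 < - a_star p"
  shows "0 < phase_inv p y" "phase p (phase_inv p y) = y"
  using phase_onto[OF assms] phase_inv_phase by auto

lemma phase_inv_deriv:
  assumes y: "y\<^sup>2 < - a_star p"
  shows "(phase_inv p has_real_derivative phase_inv' p y) (at y)"
proof -
  define x where "x = phase_inv p y"
  have x: "0 < x" "phase p x = y" using phase_phase_inv[OF y] by (auto simp: x_def)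
  have "isCont (phase_inv p) (phase p x)"
    by (rule isCont_inverse_function2[of "x/2" x "2*x"])
      (use x phase_inv_phase DERIV_isCont[OF phase_deriv] in auto)
  then have cont: "isCont (phase_inv p) y" by (simp add: x)
  have bd: "z\<^sup>2 < - a_star p" if "- sqrt (- a_star p) < z" "z < sqrt (- a_star p)" for z
    using that real_sqrt_less_iff[of "z\<^sup>2" "- a_star p"] by auto
  have yb: "- sqrt (- a_star p) < y" "y < sqrt (- a_star p)"
    using real_sqrt_less_mono[OF y] by auto
  have "(phase_inv p has_real_derivative inverse (curv p x / sqrt (defect_quot p x))) (at y)"
    by (rule DERIV_inverse_function[OF _ _ yb _ cont])
      (use phase_deriv[OF x(1)] curv_pos[OF x(1)] defect_quot_pos[OF x(1)] phase_phase_inv(2)[OF bd]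
       in \<open>auto simp: x_def\<close>)
  then show ?thesis by (simp add: phase_inv'_def x_def)
qed

lemma isCont_phase_inv: "y\<^sup>2 < - a_star p \<Longrightarrow> isCont (phase_inv p) y"
  using phase_inv_deriv by (rule DERIV_isCont)

lemma isCont_phase_inv':
  assumes y: "y\<^sup>2 < - a_star p"
  shows "isCont (phase_inv' p) y"
proof -
  note x = phase_phase_inv(1)[OF y]
  have "isCont (\<lambda>y. sqrt (defect_quot p (phase_inv p y))) y"
    by (intro isCont_o2[OF isCont_phase_inv[OF y]] continuous_intros isCont_defect_quot x)
  moreover have "isCont (\<lambda>y. curv p (phase_inv p y)) y"
    by (intro isCont_o2[OF isCont_phase_inv[OF y]] isCont_curv x)
  ultimately show ?thesis
    unfolding phase_inv'_def[abs_def] by (rule continuous_divide) (use curv_pos[OF x] in auto)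
qed

lemma phase_inv'_pos: "y\<^sup>2 < - a_star p \<Longrightarrow> 0 < phase_inv' p y"
  unfolding phase_inv'_def by (intro divide_pos_pos curv_pos)
    (simp_all add: phase_phase_inv defect_quot_pos)

lemma fpa_phase_inv:
  assumes "y\<^sup>2 < - a_star p"
  shows "fpa p a (phase_inv p y) = (a - a_star p) - y\<^sup>2"
  using phase_phase_inv[OF assms] phase_squared[of "phase_inv p y"] by (simp add: fpa_eq_defect)

section \<open>The transformed integral\<close>

text \<open>
  For \<open>p > 1\<close> the denominator exceeds \<open>fpa p a x\<close> by the positive term \<open>(p - 1)\<^sup>2 * x powr (2 * p)\<close>; for \<open>p < 0\<close> it is a
  sum of a negative and a nonpositive term. So it never vanishes where the radicand is nonnegative, in
  particular not at \<open>crit p\<close> for \<open>a = a_star p\<close>.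
\<close>

lemma denominator_sign:
  assumes "0 < x" "a < 0" "0 \<le> fpa p a x"
  shows "0 < eps2 p * (a + eps2 p * p\<^sup>2 * x powr (2 * (p - 1)))"
proof (cases "p > 1")
  case True
  have "0 < (p - 1)\<^sup>2 * x powr (2 * p)" using True assms by simp
  then show ?thesis using assms(3) True by (simp add: fpa_def eps2_def eps_def)
next
  case False
  have "0 \<le> p\<^sup>2 * x powr (2 * (p - 1))" by simp
  then have "a < p\<^sup>2 * x powr (2 * (p - 1))" using assms(2) by linarith
  then show ?thesis using False by (simp add: eps2_def eps_def)
qed

end

text \<open>
  The integrand without its square root. The factor \<open>eps2 p\<close> makes it nonnegative for both ranges of
  \<open>p\<close>, as the substitution requires; it is compensated in \<open>Lambda_integrand_eq_weight\<close>.
\<close>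

definition weight :: "real \<Rightarrow> real \<Rightarrow> real \<Rightarrow> real" where
  "weight p a x = x powr (2 * (p - 1)) / (eps2 p * (a + eps2 p * p\<^sup>2 * x powr (2 * (p - 1))))"

definition sine_arc :: "real \<Rightarrow> real \<Rightarrow> real \<Rightarrow> real" where
  "sine_arc p a \<theta> = sqrt (a - a_star p) * sin \<theta>"

definition arc_integrand :: "real \<Rightarrow> real \<Rightarrow> real \<Rightarrow> real" where
  "arc_integrand p a \<theta> = weight p a (phase_inv p (sine_arc p a \<theta>)) * phase_inv' p (sine_arc p a \<theta>)"

definition Lambda_arc :: "real \<Rightarrow> real \<Rightarrow> real" where
  "Lambda_arc p a = 2 * p * (p - 1)\<^sup>2 * sqrt (- a) * eps2 p *
     integral {-(pi/2)..pi/2} (arc_integrand p a)"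

lemma Lambda_integrand_eq_weight:
  "Lambda_integrand p a x = eps2 p * (weight p a x / sqrt (fpa p a x))"
proof -
  have "t / (u * v) = eps2 p * (t / (eps2 p * u) / v)" for t u v by (auto simp: eps2_def eps_def)
  then show ?thesis unfolding Lambda_integrand_def weight_def fpa_def .
qed

context
  fixes p :: real
  assumes p: "p < 0 \<or> p > 1"
begin

text \<open>
  The arcsine substitution with \<open>N = weight p a\<close> and \<open>R = fpa p a\<close>: in the coordinate \<open>phase p\<close> the
  interval from \<open>beta p a\<close> to \<open>alpha p a\<close> is symmetric about \<open>0\<close>, and the radicand is \<open>c\<^sup>2 - y\<^sup>2\<close>.
\<close>

lemma Lambda_eq_Lambda_arc:
  assumes a: "a_star p < a" "a < 0"
  shows "interval_lebesgue_integrable lborel (beta p a) (alpha p a) (Lambda_integrand p a)"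
    and "Lambda p a = Lambda_arc p a"
proof -
  define c where "c = sqrt (a - a_star p)"
  have c: "0 < c" "c\<^sup>2 = a - a_star p" using a by (simp_all add: c_def)
  have y: "y\<^sup>2 < - a_star p" "y\<^sup>2 \<le> c\<^sup>2" if "y \<in> {-c..c}" for y
  proof -
    show "y\<^sup>2 \<le> c\<^sup>2" using that c(1) by (simp add: abs_le_square_iff[symmetric] abs_le_iff)
    then show "y\<^sup>2 < - a_star p" using c(2) a by simp
  qed
  have ends: "phase_inv p (-c) = beta p a" "phase_inv p c = alpha p a"
    using phase_inv_phase[OF p phase_endpoints(1)[OF p a]] phase_inv_phase[OF p phase_endpoints(2)[OF p a]]
    unfolding phase_endpoints(3,4)[OF p a] by (simp_all add: c_def)
  note x = phase_phase_inv(1)[OF p y(1)]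
  have R: "fpa p a (phase_inv p y) = c\<^sup>2 - y\<^sup>2" if "y \<in> {-c..c}" for y
    using fpa_phase_inv[OF p y(1)[OF that]] c by simp
  have den: "0 < eps2 p * (a + eps2 p * p\<^sup>2 * phase_inv p y powr (2 * (p - 1)))" if "y \<in> {-c..c}" for y
    using denominator_sign[OF p x[OF that] a(2)] R[OF that] y[OF that] by simp
  have 1: "isCont (weight p a) (phase_inv p y)" if "y \<in> {-c..c}" for y
    unfolding weight_def[abs_def] using x[OF that] den[OF that] by (intro continuous_intros) auto
  have 2: "0 \<le> weight p a (phase_inv p y)" if "y \<in> {-c..c}" for y
    unfolding weight_def by (rule divide_nonneg_pos[OF _ den[OF that]]) simp
  have 3: "isCont (fpa p a) (phase_inv p y)" if "y \<in> {-c..c}" for y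
    using fpa_deriv[OF x[OF that]] by (rule DERIV_isCont)
  have 4: "continuous_on {-c..c} (phase_inv' p)"
    using isCont_phase_inv'[OF p y(1)] by (intro continuous_at_imp_continuous_on) auto
  have S: "interval_lebesgue_integrable lborel (beta p a) (alpha p a)
      (\<lambda>x. weight p a x / sqrt (fpa p a x))"
    "(LBINT x=beta p a..alpha p a. weight p a x / sqrt (fpa p a x)) =
      integral {-(pi/2)..pi/2} (arc_integrand p a)"
    unfolding ends[symmetric] arc_integrand_def[abs_def] sine_arc_def c_def[symmetric]
    by (rule arcsine_substitution[OF c(1) phase_inv_deriv[OF p y(1)] 4
        less_imp_le[OF phase_inv'_pos[OF p y(1)]] 1 2 3 R]; assumption)+
  show "interval_lebesgue_integrable lborel (beta p a) (alpha p a) (Lambda_integrand p a)"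
    unfolding Lambda_integrand_eq_weight[abs_def]
    by (rule interval_lebesgue_integrable_mult_right) (rule S(1))
  have "(LBINT x=beta p a..alpha p a. Lambda_integrand p a x) =
      eps2 p * integral {-(pi/2)..pi/2} (arc_integrand p a)"
    unfolding Lambda_integrand_eq_weight interval_lebesgue_integral_mult_right
    unfolding S(2) ..
  then show "Lambda p a = Lambda_arc p a"
    by (simp add: Lambda_def Lambda_arc_def)
qed

text \<open>
  Along the arc, \<open>y\<^sup>2 \<le> a - a_star p < - a_star p\<close>. The second inequality keeps \<open>y\<close> inside the domain of \<open>phase_inv p\<close>, and the
  first one makes the radicand nonnegative and hence the denominator nonzero. Both persist at \<open>a = a_star p\<close>.
\<close>

lemma continuous_on_Lambda_arc: "continuous_on {a_star p..<0} (Lambda_arc p)"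
proof -
  let ?U = "{a_star p..<0}" and ?D = "{y. y\<^sup>2 < - a_star p}"
  let ?T = "?U \<times> cbox (-(pi/2)) (pi/2)"
  have "continuous_on ?U (\<lambda>a. integral (cbox (-(pi/2)) (pi/2)) (arc_integrand p a))"
  proof (rule integral_continuous_on_param)
    let ?y = "\<lambda>z. sine_arc p (fst z) (snd z)"
    have cy: "continuous_on ?T ?y" unfolding sine_arc_def by (intro continuous_intros)
    have sq: "(?y z)\<^sup>2 = (fst z - a_star p) * (sin (snd z))\<^sup>2" if "z \<in> ?T" for z
      using that by (simp add: sine_arc_def power_mult_distrib mem_Times_iff)
    have le: "(?y z)\<^sup>2 \<le> fst z - a_star p" if "z \<in> ?T" for z
      unfolding sq[OF that] using that by (intro mult_left_le) (auto simp: abs_square_le_1)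
    have D: "(?y z)\<^sup>2 < - a_star p" if "z \<in> ?T" for z
      using le[OF that] that by auto
    note x = phase_phase_inv(1)[OF p D]
    have den: "0 < eps2 p * (fst z + eps2 p * p\<^sup>2 * phase_inv p (?y z) powr (2 * (p - 1)))"
      if "z \<in> ?T" for z
      using that le[OF that] by (intro denominator_sign[OF p x[OF that]])
        (auto simp: fpa_phase_inv[OF p D[OF that]])
    have sub: "?y ` ?T \<subseteq> ?D" using D by blast
    have cx: "continuous_on ?T (\<lambda>z. phase_inv p (?y z))"
    proof (rule continuous_on_compose2[where g = "phase_inv p", OF _ cy sub])
      show "continuous_on ?D (phase_inv p)"
        using isCont_phase_inv[OF p] by (intro continuous_at_imp_continuous_on) blast
    qed
    have cx': "continuous_on ?T (\<lambda>z. phase_inv' p (?y z))"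
    proof (rule continuous_on_compose2[where g = "phase_inv' p", OF _ cy sub])
      show "continuous_on ?D (phase_inv' p)"
        using isCont_phase_inv'[OF p] by (intro continuous_at_imp_continuous_on) blast
    qed
    have cpow: "continuous_on ?T (\<lambda>z. phase_inv p (?y z) powr (2 * (p - 1)))"
      by (rule continuous_on_powr[OF cx continuous_on_const]) (use x in force)
    have "continuous_on ?T (\<lambda>z. weight p (fst z) (phase_inv p (?y z)))"
      unfolding weight_def
    proof (rule continuous_on_divide[OF cpow])
      show "continuous_on ?T
          (\<lambda>z. eps2 p * (fst z + eps2 p * p\<^sup>2 * phase_inv p (?y z) powr (2 * (p - 1))))"
        by (intro continuous_on_mult continuous_on_add continuous_on_const cpow
            continuous_on_fst continuous_on_id)
      show "\<forall>z\<in>?T. eps2 p * (fst z + eps2 p * p\<^sup>2 * phase_inv p (?y z) powr (2 * (p - 1))) \<noteq> 0"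
        by (intro ballI less_imp_neq[THEN not_sym] den)
    qed
    then have "continuous_on ?T (\<lambda>z. weight p (fst z) (phase_inv p (?y z)) * phase_inv' p (?y z))"
      using cx' by (rule continuous_on_mult)
    then show "continuous_on ?T (\<lambda>(a, \<theta>). arc_integrand p a \<theta>)"
      by (simp only: arc_integrand_def case_prod_unfold)
  qed
  then have "continuous_on ?U (\<lambda>a. integral {-(pi/2)..pi/2} (arc_integrand p a))"
    by (simp only: cbox_interval)
  moreover have "continuous_on ?U (\<lambda>a. 2 * p * (p - 1)\<^sup>2 * sqrt (- a) * eps2 p)"
    by (intro continuous_intros)
  ultimately show ?thesis unfolding Lambda_arc_def by (rule continuous_on_mult[rotated])
qed

text \<open>
  At \<open>a = a_star p\<close> the arc degenerates to the point \<open>y = 0\<close>, that is \<open>x = crit p\<close>. With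
  \<open>P = eps2 p * p\<close>, \<open>T = eps2 p * (p - 1)\<close> and \<open>r = crit p powr (p - 1)\<close>, the data there are
  \<open>- a_star p = P * r\<^sup>2\<close>, \<open>curv p (crit p) = 2 * P * T\<^sup>2 * r\<^sup>2\<close> and weight \<open>1 / (P * T)\<close>, and all
  of \<open>P\<close>, \<open>T\<close>, \<open>r\<close> cancel.
\<close>

lemma Lambda_arc_a_star: "Lambda_arc p (a_star p) = sqrt 2 * pi"
proof -
  let ?k = "crit p" and ?s = "eps2 p"
  define r where "r = ?k powr (p - 1)"
  have k: "0 < ?k" by (rule crit_pos[OF p])
  have r: "0 < r" using k by (simp add: r_def)
  have r2: "?k powr (2 * (p - 1)) = r\<^sup>2"
    by (simp add: r_def power2_eq_square powr_add[symmetric])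
  have sp: "0 < ?s * p" by (rule eps2_mult_p_pos[OF p])
  have s1: "0 < ?s * (p - 1)" using p by (auto simp: eps2_def eps_def)
  have ss: "?s * ?s = 1" by (rule eps2_squared)
  have "?k powr (2 * p - 3) * ?k = ?k powr (2 * (p - 1))"
    using k powr_add[of ?k "2 * p - 3" 1] by (simp add: algebra_simps)
  then have kr: "?k powr (2 * p - 3) * ?k = r\<^sup>2" unfolding r2 .
  have curv: "curv p ?k = 2 * (?s * p) * (?s * (p - 1))\<^sup>2 * r\<^sup>2"
  proof -
    have "(?s * (p - 1))\<^sup>2 = (p - 1)\<^sup>2"
      using ss by (simp add: power_mult_distrib power2_eq_square)
    moreover have "curv p ?k = 2 * (?s * p) * (p - 1)\<^sup>2 * (?k powr (2 * p - 3) * ?k)"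
      by (simp add: curv_def)
    ultimately show ?thesis by (simp only: kr)
  qed
  have a: "- a_star p = ?s * p * r\<^sup>2"
  proof -
    have "0 = a_star p + ?s * r\<^sup>2 * (p\<^sup>2 - (p - 1) * ((p - 1) * ?k\<^sup>2))"
      using defect_crit[OF p] fpa_factor[OF k, of p "a_star p"] r2
      by (simp add: defect_def power2_eq_square algebra_simps)
    then show ?thesis unfolding crit_squared[OF p] by (simp add: power2_eq_square algebra_simps)
  qed
  have inv0: "phase_inv p 0 = ?k"
    using phase_inv_phase[OF p k] by (simp add: phase_def)
  have w: "weight p (a_star p) ?k = 1 / (?s * p * (?s * (p - 1)))"
  proof -
    have "a_star p + ?s * p\<^sup>2 * ?k powr (2 * (p - 1)) = p * (?s * (p - 1)) * r\<^sup>2"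
      using a unfolding r2 by (simp add: power2_eq_square algebra_simps)
    then show ?thesis unfolding weight_def r2 using r by simp
  qed
  have i0: "phase_inv' p 0 = 1 / (sqrt (2 * (?s * p)) * (?s * (p - 1)) * r)"
  proof -
    have "phase_inv' p 0 = 1 / sqrt (curv p ?k)"
      using curv_pos[OF p k] by (simp add: phase_inv'_def inv0 defect_quot_def divide_simps)
    also have "curv p ?k = (sqrt (2 * (?s * p)) * (?s * (p - 1)) * r)\<^sup>2"
      unfolding curv using sp by (simp add: power_mult_distrib)
    finally show ?thesis using sp s1 r by simp
  qed
  have cancel: "2 * P * T\<^sup>2 * (sqrt P * r) * (pi * (1 / (P * T) * (1 / (sqrt (2 * P) * T * r)))) =
      2 / sqrt 2 * pi" if "0 < P" "0 < T" for P T
  proof -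
    have "2 * P * T\<^sup>2 * (q * r) * (pi * (1 / (P * T) * (1 / (u * q * T * r)))) = 2 / u * pi"
      if "q \<noteq> 0" for q u
      using that \<open>0 < P\<close> \<open>0 < T\<close> r by (simp add: power2_eq_square)
    from this[of "sqrt P" "sqrt 2"] show ?thesis using that by (simp only: real_sqrt_mult) simp
  qed
  have "arc_integrand p (a_star p) =
      (\<lambda>\<theta>. 1 / (?s * p * (?s * (p - 1))) * (1 / (sqrt (2 * (?s * p)) * (?s * (p - 1)) * r)))"
    by (simp add: arc_integrand_def sine_arc_def inv0 w i0 fun_eq_iff)
  then have "Lambda_arc p (a_star p) = 2 * (?s * p) * (p - 1)\<^sup>2 * (sqrt (?s * p) * r) *
     (pi * (1 / (?s * p * (?s * (p - 1))) * (1 / (sqrt (2 * (?s * p)) * (?s * (p - 1)) * r))))"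
    unfolding Lambda_arc_def a using r by (simp add: real_sqrt_mult)
  moreover have "(p - 1)\<^sup>2 = (?s * (p - 1))\<^sup>2"
    unfolding power_mult_distrib using ss by (simp add: power2_eq_square)
  moreover have "2 / sqrt 2 = sqrt (2::real)" by (rule real_div_sqrt) simp
  ultimately show ?thesis using cancel[OF sp s1] by (simp only:)
qed

end

section \<open>Integrability, continuity and the limit at the minimal parameter\<close>

theorem lemma5p1:
  fixes p :: real
  assumes "p \<in> {..<0} \<union> {1<..}"
  shows "(\<forall>a\<in>{a_star p<..<0}.
            interval_lebesgue_integrable lborel (beta p a) (alpha p a) (Lambda_integrand p a)) \<and>
         continuous_on {a_star p<..<0} (Lambda p) \<and>
         (Lambda p \<longlongrightarrow> sqrt 2 * pi) (at_right (a_star p))"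
proof -
  have p: "p < 0 \<or> p > 1" using assms by auto
  have neg: "a_star p < 0" by (rule a_star_neg[OF p])
  note cont = continuous_on_Lambda_arc[OF p]
  have "continuous_on {a_star p<..<0} (Lambda_arc p)"
    by (rule continuous_on_subset[OF cont]) auto
  then have "continuous_on {a_star p<..<0} (Lambda p)"
    by (rule continuous_on_eq) (simp add: Lambda_eq_Lambda_arc(2)[OF p])
  moreover have "(Lambda p \<longlongrightarrow> sqrt 2 * pi) (at_right (a_star p))"
  proof -
    have within: "at (a_star p) within {a_star p..<0} = at_right (a_star p)"
      using neg by (intro at_within_nhd[of _ "{..<0}"]) auto
    have "(Lambda_arc p \<longlongrightarrow> Lambda_arc p (a_star p)) (at (a_star p) within {a_star p..<0})"
      using cont neg by (auto simp: continuous_on_def)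
    then have "(Lambda_arc p \<longlongrightarrow> sqrt 2 * pi) (at_right (a_star p))"
      unfolding Lambda_arc_a_star[OF p] by (simp add: within)
    moreover have "\<forall>\<^sub>F a in at_right (a_star p). Lambda_arc p a = Lambda p a"
      using eventually_at_right_real[OF neg]
      by eventually_elim (simp add: Lambda_eq_Lambda_arc(2)[OF p])
    ultimately show ?thesis by (rule Lim_transform_eventually)
  qed
  ultimately show ?thesis using Lambda_eq_Lambda_arc(1)[OF p] by auto
qed

end
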